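(* For each integer $n\ge 0$, let $LG_2(n)$ denote the number of partitions of $n$ in which any two parts differ by at least $2$, no part equals $1$, and no two consecutive odd numbers (that is, $2s+1$ and $2s-1$ for some integer $s$) both appear as parts. Let $\overline{LG_2}(n)$ denote the number of overpartitions of $n$ in which the non-overlined parts are even and distinct, and the overlined parts are odd and each at most $2r$, where $r$ is the number of non-overlined parts. Then $LG_2(n)=\overline{LG_2}(n)$ for every $n\ge 0$.
   Context: A partition of $n$ is a weakly decreasing finite sequence of positive integers (its parts) with sum $n$; parts at different positions count as different parts, so "differ by at least $2$" excludes repeated parts. An overpartition of $n$ is a weakly decreasing finite sequence of positive integers with sum $n$ in which the last occurrence of a part of each given magnitude may or may not be overlined. Thus the overlined parts are automatically distinct from one another. "The non-overlined parts are distinct" means that they are pairwise distinct among themselves. Conditions on parts of a given kind are vacuous if there are no such parts. There is exactly one partition and one overpartition of $0$ (the empty one). *)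

theory Defs
  imports Main
begin

definition partitions :: "nat \<Rightarrow> nat list set" where
  "partitions n = {xs. sorted_wrt (\<ge>) xs \<and> (\<forall>x\<in>set xs. x > 0) \<and> sum_list xs = n}"

text \<open>
  A part of an overpartition is a pair of its magnitude and a flag, which is \<^term>\<open>True\<close>
  iff the part is overlined.
\<close>

definition overlined :: "(nat \<times> bool) list \<Rightarrow> nat list" where
  "overlined ps = map fst (filter snd ps)"

definition non_overlined :: "(nat \<times> bool) list \<Rightarrow> nat list" where
  "non_overlined ps = map fst (filter (\<lambda>p. \<not> snd p) ps)"

text \<open>
  Only the last occurrence of each magnitude may be overlined: a part that is followed by a
  part of the same magnitude is not.
\<close>

definition overpartitions :: "nat \<Rightarrow> (nat \<times> bool) list set" where
  "overpartitions n = {ps. map fst ps \<in> partitions n \<and>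
     (\<forall>i j. i < j \<and> j < length ps \<and> fst (ps ! i) = fst (ps ! j) \<longrightarrow> \<not> snd (ps ! i))}"

text \<open>
  The parts are listed in decreasing order, so the first condition says that parts at different
  positions differ by at least 2. In the last condition \<open>s\<close> ranges over the integers, so that
  \<open>2 * s - 1\<close> is not truncated.
\<close>

definition LG2 :: "nat \<Rightarrow> nat" where
  "LG2 n = card {xs \<in> partitions n.
     sorted_wrt (\<lambda>x y. x \<ge> y + 2) xs \<and>
     1 \<notin> set xs \<and>
     \<not> (\<exists>s::int. 2 * s + 1 \<in> int ` set xs \<and> 2 * s - 1 \<in> int ` set xs)}"

definition LG2_bar :: "nat \<Rightarrow> nat" where
  "LG2_bar n = card {ps \<in> overpartitions n.
     (\<forall>x\<in>set (non_overlined ps). even x) \<and> distinct (non_overlined ps) \<and>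
     (\<forall>x\<in>set (overlined ps). odd x \<and> x \<le> 2 * length (non_overlined ps))}"

text \<open>Finiteness, so that \<^const>\<open>card\<close> above does count.\<close>

lemma finite_partitions: "finite (partitions n)"
proof (rule finite_subset)
  have "length xs \<le> sum_list xs" if "\<forall>x\<in>set xs. x > 0" for xs :: "nat list"
    using that by (induction xs) auto
  then show "partitions n \<subseteq> {xs. set xs \<subseteq> {..n} \<and> length xs \<le> n}"
    by (auto simp: partitions_def member_le_sum_list)
  show "finite {xs. set xs \<subseteq> {..n} \<and> length xs \<le> n}"
    by (rule finite_lists_length_le) simp
qed

lemma finite_overpartitions: "finite (overpartitions n)"
proof (rule finite_subset)
  have "p \<in> {..n} \<times> UNIV" if "map fst ps \<in> partitions n" "p \<in> set ps" for p ps
  proof -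
    have "fst p \<in> set (map fst ps)" using that(2) by simp
    then have "fst p \<le> sum_list (map fst ps)" by (simp only: member_le_sum_list)
    then show ?thesis using that(1) by (cases p) (auto simp: partitions_def)
  qed
  moreover have "length xs \<le> sum_list xs" if "\<forall>x\<in>set xs. x > 0" for xs :: "nat list"
    using that by (induction xs) auto
  then have "length ps \<le> n" if "map fst ps \<in> partitions n" for ps :: "(nat \<times> bool) list"
    using that unfolding partitions_def by (metis (mono_tags, lifting) length_map mem_Collect_eq)
  ultimately show "overpartitions n \<subseteq>
      {ps. set ps \<subseteq> {..n} \<times> (UNIV :: bool set) \<and> length ps \<le> n}"
    unfolding overpartitions_def by blast
  show "finite {ps. set ps \<subseteq> {..n} \<times> (UNIV :: bool set) \<and> length ps \<le> n}"
    by (rule finite_lists_length_le) simp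
qed

end

theory Submission
  imports Defs
begin

text \<open>
  Both sides count the pairs \<open>(E, M)\<close> where \<open>E\<close> is a strictly decreasing list of positive even
  numbers and \<open>M\<close> is a set of odd numbers below \<open>2 * length E\<close>, with total sum \<open>n\<close>.

  For the overpartitions this is a matter of bookkeeping. Overlined parts are pairwise distinct,
  the non-overlined ones are so by assumption, and the two kinds have opposite parity. Hence all
  parts are distinct, the flag of a part is its parity, and the overpartition is recovered from the
  set of its parts (lemma \<open>bij_betw_overpartitions_pairs\<close>).

  For the partitions \<open>x\<^sub>0 > x\<^sub>1 > \<dots> > x\<^bsub>r-1\<^esub>\<close> on the left-hand side, the condition on neighbouring
  parts says exactly \<open>\<lceil>x\<^bsub>i+1\<^esub> / 2\<rceil> < \<lfloor>x\<^sub>i / 2\<rfloor>\<close>, and excluding the part 1 says that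
  \<open>0 < \<lfloor>x\<^bsub>r-1\<^esub> / 2\<rfloor>\<close>. So the rounded-down halves strictly decrease to a positive number, and each
  odd part raises the lower bound on the halves of all larger parts by one more. Replacing \<open>x\<^sub>i\<close> by
  \<open>e\<^sub>i = 2 * (\<lfloor>x\<^sub>i / 2\<rfloor> - c\<^sub>i)\<close>, where \<open>c\<^sub>i\<close> is the number of odd parts after position \<open>i\<close>, therefore
  turns the condition into \<open>e\<^sub>0 > e\<^sub>1 > \<dots> > e\<^bsub>r-1\<^esub> > 0\<close>. What an odd part at position \<open>i\<close> costs
  is 1 at its own position and 2 at each of the \<open>i\<close> earlier ones, so the amount removed on its
  account is \<open>2 * i + 1\<close>. Collecting these numbers in \<open>M\<close> keeps the sum unchanged and remembers
  which positions were odd, so the \<open>x\<^sub>i\<close> can be recovered (lemma \<open>bij_betw_gollnitz_pairs\<close>).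
  In terms of diagrams, this strips the columns that end in a 1 from a 2-modular Ferrers diagram.
\<close>

section \<open>Parts without close or consecutive odd neighbours\<close>

text \<open>
  The gap condition of the partitions on the left-hand side, as a condition on rounded halves. In
  this form it is visibly transitive, so that it need only be checked for neighbouring parts.
\<close>

definition wide_gap :: "nat \<Rightarrow> nat \<Rightarrow> bool" where
  "wide_gap x y \<longleftrightarrow> (y + 1) div 2 < x div 2"

definition little_gollnitz :: "nat list \<Rightarrow> bool" where
  "little_gollnitz xs \<longleftrightarrow> sorted_wrt wide_gap xs \<and> (\<forall>x\<in>set xs. 2 \<le> x)"

lemma wide_gap_iff_halves: "wide_gap x y \<longleftrightarrow> y div 2 + y mod 2 < x div 2"
  unfolding wide_gap_def by (cases "odd y") (auto elim!: oddE evenE)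

lemma transp_wide_gap: "transp wide_gap"
  unfolding wide_gap_iff_halves by (intro transpI) linarith

lemma wide_gap_iff: "wide_gap x y \<longleftrightarrow> y + 2 \<le> x \<and> \<not> (odd y \<and> x = y + 2)"
  unfolding wide_gap_def by (cases "odd x"; cases "odd y") (auto elim!: oddE evenE)

lemma little_gollnitz_Nil: "little_gollnitz []"
  by (simp add: little_gollnitz_def)

lemma little_gollnitz_Cons:
  "little_gollnitz (x # xs) \<longleftrightarrow> 2 \<le> x \<and> (xs \<noteq> [] \<longrightarrow> wide_gap x (hd xs)) \<and> little_gollnitz xs"
  by (cases xs) (auto simp: little_gollnitz_def sorted_wrt2[OF transp_wide_gap] sorted_wrt1 simp del: sorted_wrt.simps(2))

lemma sorted_greater_Cons:
  "sorted_wrt (>) (x # xs) \<longleftrightarrow> (xs \<noteq> [] \<longrightarrow> hd xs < x) \<and> sorted_wrt (>) xs" for x :: nat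
  by (cases xs) (auto simp: sorted_wrt2[OF transp_on_greater] sorted_wrt1 simp del: sorted_wrt.simps(2))

text \<open>
  The pairwise conditions in the definition of \<^const>\<open>LG2\<close> amount to \<^const>\<open>wide_gap\<close>: given
  differences of at least 2, two odd parts are too close for \<^const>\<open>wide_gap\<close> exactly if they are
  consecutive odd numbers.
\<close>

lemma little_gollnitz_iff:
  assumes "\<forall>x\<in>set xs. 0 < x"
  shows "little_gollnitz xs \<longleftrightarrow> sorted_wrt (\<lambda>x y. x \<ge> y + 2) xs \<and> 1 \<notin> set xs \<and>
     \<not> (\<exists>s::int. 2 * s + 1 \<in> int ` set xs \<and> 2 * s - 1 \<in> int ` set xs)"
    (is "_ \<longleftrightarrow> ?gap \<and> ?no1 \<and> ?noconsec")
proof -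
  have consec: "?noconsec \<longleftrightarrow> (\<forall>y\<in>set xs. odd y \<longrightarrow> y + 2 \<notin> set xs)"
  proof safe
    fix y assume "\<not> (\<exists>s::int. 2 * s + 1 \<in> int ` set xs \<and> 2 * s - 1 \<in> int ` set xs)"
      and y: "y \<in> set xs" "odd y" "y + 2 \<in> set xs"
    moreover obtain k where "y = 2 * k + 1" using y(2) oddE by blast
    ultimately have "2 * int (k + 1) + 1 \<notin> int ` set xs \<or> 2 * int (k + 1) - 1 \<notin> int ` set xs"
      by blast
    moreover have "2 * int (k + 1) + 1 = int (y + 2)" "2 * int (k + 1) - 1 = int y"
      using \<open>y = 2 * k + 1\<close> by simp_all
    ultimately show False using y by (metis imageI)
  next
    fix s :: int and a b
    assume *: "\<forall>y\<in>set xs. odd y \<longrightarrow> y + 2 \<notin> set xs" "a \<in> set xs" "b \<in> set xs"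
      and "2 * s + 1 = int a" "2 * s - 1 = int b"
    then have "a = b + 2" "odd b" by presburger+
    with * show False by blast
  qed
  have "sorted_wrt wide_gap xs \<longleftrightarrow> ?gap \<and> (\<forall>y\<in>set xs. odd y \<longrightarrow> y + 2 \<notin> set xs)"
    by (induction xs) (fastforce simp: wide_gap_iff)+
  moreover have "(\<forall>x\<in>set xs. 2 \<le> x) \<longleftrightarrow> ?no1"
    using assms by (metis One_nat_def Suc_1 Suc_leI le_antisym not_less_eq_eq one_le_numeral nat_less_le)
  ultimately show ?thesis unfolding little_gollnitz_def consec by blast
qed

section \<open>Stripping the odd parts\<close>

definition admissible_pairs :: "nat \<Rightarrow> (nat list \<times> nat set) set" where
  "admissible_pairs n = {(E, M). sorted_wrt (>) E \<and> (\<forall>e\<in>set E. even e \<and> 0 < e) \<and>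
     M \<subseteq> {m. odd m \<and> m \<le> 2 * length E} \<and> sum_list E + \<Sum>M = n}"

text \<open>
  The closed form is \<open>{2 * i + 1 | i. i < length xs \<and> odd (xs ! i)}\<close>. In particular the cardinality
  is the number of odd parts, which is how \<open>even_core\<close> uses it.
\<close>

fun odd_marks :: "nat list \<Rightarrow> nat set" where
  "odd_marks [] = {}"
| "odd_marks (x # xs) = (if odd x then {1} else {}) \<union> (\<lambda>m. m + 2) ` odd_marks xs"

fun even_core :: "nat list \<Rightarrow> nat list" where
  "even_core [] = []"
| "even_core (x # xs) = 2 * (x div 2 - card (odd_marks xs)) # even_core xs"

text \<open>
  The inverse. The set \<open>{m. m + 2 \<in> M}\<close> holds the marks of the tail; its cardinality is the number
  of odd parts there, and \<open>1 \<in> M\<close> says that the head is odd.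
\<close>

fun rebuild :: "nat list \<Rightarrow> nat set \<Rightarrow> nat list" where
  "rebuild [] M = []"
| "rebuild (e # E) M =
     (e + 2 * card {m. m + 2 \<in> M} + of_bool (1 \<in> M)) # rebuild E {m. m + 2 \<in> M}"

lemma finite_odd_marks: "finite (odd_marks xs)"
  by (induction xs) auto

lemma shift_odd_marks: "{m. m + 2 \<in> odd_marks (x # xs)} = odd_marks xs"
  by auto

lemma one_in_odd_marks_iff: "1 \<in> odd_marks (x # xs) \<longleftrightarrow> odd x"
  by auto

text \<open>
  Shifting all marks of the tail by 2 is what pays for the 2 that every odd part of the tail takes
  from the head.
\<close>

lemma card_odd_marks_Cons: "card (odd_marks (x # xs)) = x mod 2 + card (odd_marks xs)"
  and sum_odd_marks_Cons: "\<Sum>(odd_marks (x # xs)) = x mod 2 + \<Sum>(odd_marks xs) + 2 * card (odd_marks xs)"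
proof -
  let ?S = "(\<lambda>m. m + 2) ` odd_marks xs"
  have inj: "inj_on (\<lambda>m. m + 2) (odd_marks xs)" by (rule inj_onI) simp
  have "finite ?S" "1 \<notin> ?S" using finite_odd_marks by auto
  moreover have "card ?S = card (odd_marks xs)" using inj by (rule card_image)
  moreover have "\<Sum>?S = \<Sum>(odd_marks xs) + 2 * card (odd_marks xs)"
    unfolding sum.reindex[OF inj] by (simp only: o_def sum.distrib sum_constant mult.commute of_nat_id)
  ultimately show "card (odd_marks (x # xs)) = x mod 2 + card (odd_marks xs)"
    "\<Sum>(odd_marks (x # xs)) = x mod 2 + \<Sum>(odd_marks xs) + 2 * card (odd_marks xs)"
    unfolding odd_marks.simps by (cases "odd x"; simp del: add_2_eq_Suc' add: odd_iff_mod_2_eq_one)+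
qed

lemma length_even_core: "length (even_core xs) = length xs"
  by (induction xs) auto

lemma odd_marks_subset: "odd_marks xs \<subseteq> {m. odd m \<and> m \<le> 2 * length xs}"
  by (induction xs) auto

text \<open>
  Each odd part among \<open>xs\<close> widens the gap between halves by one, and the smallest half is already
  positive. So the subtraction in \<^const>\<open>even_core\<close> does not truncate, and its value is positive.
\<close>

lemma card_odd_marks_less_half:
  "little_gollnitz (x # xs) \<Longrightarrow> card (odd_marks xs) < x div 2"
proof (induction xs arbitrary: x)
  case Nil
  then show ?case by (simp add: little_gollnitz_Cons)
next
  case (Cons y ys)
  then have "wide_gap x y" "card (odd_marks ys) < y div 2" by (auto simp: little_gollnitz_Cons)
  then show ?case unfolding card_odd_marks_Cons wide_gap_iff_halves by linarith
qed

lemma sum_core_marks: "little_gollnitz xs \<Longrightarrow> sum_list (even_core xs) + \<Sum>(odd_marks xs) = sum_list xs"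
proof (induction xs)
  case (Cons x xs)
  then have "sum_list (even_core xs) + \<Sum>(odd_marks xs) = sum_list xs" by (simp add: little_gollnitz_Cons)
  moreover have "card (odd_marks xs) < x div 2" using card_odd_marks_less_half Cons.prems .
  ultimately show ?case unfolding sum_odd_marks_Cons by simp presburger
qed simp

text \<open>
  If \<open>x\<close> is followed by \<open>y\<close>, then the number subtracted from half of \<open>x\<close> exceeds the one for \<open>y\<close> by
  the parity of \<open>y\<close>, which is just the excess of \<^const>\<open>wide_gap\<close> over strict decrease of the halves.
\<close>

lemma sorted_even_core: "little_gollnitz xs \<Longrightarrow> sorted_wrt (>) (even_core xs)"
proof (induction xs)
  case (Cons x xs)
  show ?case
  proof (cases xs)
    case (Cons y ys)
    have "wide_gap x y" "little_gollnitz xs" using Cons.prems Cons by (auto simp: little_gollnitz_Cons)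
    moreover have "card (odd_marks ys) < y div 2"
      using card_odd_marks_less_half \<open>little_gollnitz xs\<close> Cons by blast
    ultimately have "2 * (y div 2 - card (odd_marks ys)) < 2 * (x div 2 - card (odd_marks xs))"
      unfolding Cons card_odd_marks_Cons wide_gap_iff_halves by linarith
    then show ?thesis using Cons.IH[OF \<open>little_gollnitz xs\<close>] unfolding even_core.simps sorted_greater_Cons
      by (simp add: Cons)
  qed simp
qed simp

lemma even_core_parts: "little_gollnitz xs \<Longrightarrow> e \<in> set (even_core xs) \<Longrightarrow> even e \<and> 0 < e"
proof (induction xs)
  case (Cons x xs)
  then show ?case using card_odd_marks_less_half[of x xs] by (auto simp: little_gollnitz_Cons)
qed simp

lemma rebuild_core_marks: "little_gollnitz xs \<Longrightarrow> rebuild (even_core xs) (odd_marks xs) = xs"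
proof (induction xs)
  case (Cons x xs)
  have "2 * (x div 2 - card (odd_marks xs)) + 2 * card (odd_marks xs) + of_bool (odd x) = x"
    using card_odd_marks_less_half[OF Cons.prems] by (simp add: of_bool_def) presburger
  with Cons show ?case
    unfolding even_core.simps rebuild.simps shift_odd_marks one_in_odd_marks_iff by (simp add: little_gollnitz_Cons)
qed simp

text \<open>
  Marks of a list with head: after removing the possible mark 1 and shifting by 2, the others are
  admissible for the tail. Nothing is lost, since 0, which is not a shifted number, is even.
\<close>

context
  fixes e :: nat and E :: "nat list" and M :: "nat set"
  assumes M: "M \<subseteq> {m. odd m \<and> m \<le> 2 * length (e # E)}"
begin

lemma shift_subset: "{m. m + 2 \<in> M} \<subseteq> {m. odd m \<and> m \<le> 2 * length E}"
  using M by auto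

lemma unshift: "(if 1 \<in> M then {1} else {}) \<union> (\<lambda>m. m + 2) ` {m. m + 2 \<in> M} = M"
proof -
  have "m \<in> (\<lambda>m. m + 2) ` {m. m + 2 \<in> M}" if "m \<in> M" "m \<noteq> 1" for m
  proof -
    have "odd m" using M that(1) by blast
    then have "m = (m - 2) + 2" using that(2) by presburger
    then show ?thesis using that(1) by (metis (mono_tags, lifting) imageI mem_Collect_eq)
  qed
  then show ?thesis by auto
qed

end

lemma marks_rebuild:
  "\<forall>e\<in>set E. even e \<Longrightarrow> M \<subseteq> {m. odd m \<and> m \<le> 2 * length E} \<Longrightarrow> odd_marks (rebuild E M) = M"
proof (induction E arbitrary: M)
  case (Cons e E)
  have "odd_marks (rebuild E {m. m + 2 \<in> M}) = {m. m + 2 \<in> M}"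
    using Cons.IH[OF _ shift_subset[OF Cons.prems(2)]] Cons.prems(1) by simp
  moreover have "odd (e + 2 * card {m. m + 2 \<in> M} + of_bool (1 \<in> M)) \<longleftrightarrow> 1 \<in> M"
    using Cons.prems(1) by simp
  ultimately show ?case
    using unshift[OF Cons.prems(2)] unfolding rebuild.simps odd_marks.simps by presburger
qed auto

lemma core_rebuild:
  "\<forall>e\<in>set E. even e \<Longrightarrow> M \<subseteq> {m. odd m \<and> m \<le> 2 * length E} \<Longrightarrow> even_core (rebuild E M) = E"
proof (induction E arbitrary: M)
  case (Cons e E)
  note sub = shift_subset[OF Cons.prems(2)]
  have "even_core (rebuild E {m. m + 2 \<in> M}) = E" using Cons.IH[OF _ sub] Cons.prems(1) by simp
  moreover have "odd_marks (rebuild E {m. m + 2 \<in> M}) = {m. m + 2 \<in> M}"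
    using marks_rebuild[OF _ sub] Cons.prems(1) by simp
  ultimately show ?case using Cons.prems(1) by auto
qed simp

lemma half_add_bit: "even d \<Longrightarrow> (d + 2 * c + of_bool b) div 2 = d div 2 + c" for d c :: nat
  by (auto elim!: evenE)

text \<open>
  The argument for \<open>sorted_even_core\<close> run backwards: the number of marks grows by the parity of the next
  part, which raises a strict inequality between halves to \<^const>\<open>wide_gap\<close>.
\<close>

lemma little_gollnitz_rebuild:
  "sorted_wrt (>) E \<Longrightarrow> \<forall>e\<in>set E. even e \<and> 0 < e \<Longrightarrow>
   M \<subseteq> {m. odd m \<and> m \<le> 2 * length E} \<Longrightarrow> little_gollnitz (rebuild E M)"
proof (induction E arbitrary: M)
  case (Cons e E)
  let ?M' = "{m. m + 2 \<in> M}"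
  note sub = shift_subset[OF Cons.prems(3)]
  have E: "sorted_wrt (>) E" "\<forall>e\<in>set E. even e \<and> 0 < e" using Cons.prems by auto
  have G: "little_gollnitz (rebuild E ?M')" using Cons.IH[OF E sub] .
  have "2 \<le> e" using Cons.prems(2) by (auto elim: evenE)
  moreover have "wide_gap (e + 2 * card ?M' + of_bool (1 \<in> M)) (hd (rebuild E ?M'))"
    if nonempty: "rebuild E ?M' \<noteq> []"
  proof -
    \<comment> \<open>\<open>d\<close> and \<open>?y\<close> belong to the second position, as \<open>e\<close> and the new head do to the first.\<close>
    obtain d D where E_eq: "E = d # D" using nonempty by (cases E) auto
    let ?y = "d + 2 * card {m. m + 2 \<in> ?M'} + of_bool (1 \<in> ?M')"
    have reb: "rebuild E ?M' = ?y # rebuild D {m. m + 2 \<in> ?M'}" by (simp add: E_eq)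
    have D: "\<forall>e\<in>set D. even e" using E(2) E_eq by simp
    have "even d" "even e" "d < e" using Cons.prems E_eq by auto
    then have halves: "d div 2 < e div 2" by presburger
    have "odd_marks (rebuild D {m. m + 2 \<in> ?M'}) = {m. m + 2 \<in> ?M'}"
      using marks_rebuild[OF D shift_subset] sub E_eq by blast
    moreover have "odd_marks (rebuild E ?M') = ?M'" using marks_rebuild[OF _ sub] E(2) by simp
    ultimately have card: "card ?M' = ?y mod 2 + card {m. m + 2 \<in> ?M'}"
      using card_odd_marks_Cons reb by metis
    show ?thesis
      unfolding reb list.sel wide_gap_iff_halves half_add_bit[OF \<open>even d\<close>] half_add_bit[OF \<open>even e\<close>]
      using card halves by linarith
  qed
  ultimately show ?case using G unfolding rebuild.simps little_gollnitz_Cons by simp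
qed (simp add: little_gollnitz_Nil)

lemma bij_betw_gollnitz_pairs:
  "bij_betw (\<lambda>xs. (even_core xs, odd_marks xs)) {xs. little_gollnitz xs \<and> sum_list xs = n} (admissible_pairs n)"
proof (rule bij_betw_byWitness[where f' = "\<lambda>(E, M). rebuild E M"])
  show "\<forall>xs\<in>{xs. little_gollnitz xs \<and> sum_list xs = n}. (case (even_core xs, odd_marks xs) of (E, M) \<Rightarrow> rebuild E M) = xs"
    by (simp add: rebuild_core_marks)
  show "\<forall>p\<in>admissible_pairs n. (even_core (case p of (E, M) \<Rightarrow> rebuild E M),
      odd_marks (case p of (E, M) \<Rightarrow> rebuild E M)) = p"
    by (auto simp: admissible_pairs_def core_rebuild marks_rebuild)
  show "(\<lambda>xs. (even_core xs, odd_marks xs)) ` {xs. little_gollnitz xs \<and> sum_list xs = n} \<subseteq> admissible_pairs n"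
    using odd_marks_subset
    by (fastforce simp: admissible_pairs_def sorted_even_core sum_core_marks length_even_core dest: even_core_parts)
  have "little_gollnitz (rebuild E M) \<and> sum_list (rebuild E M) = n" if "(E, M) \<in> admissible_pairs n" for E M
  proof -
    have E: "sorted_wrt (>) E" "\<forall>e\<in>set E. even e \<and> 0 < e"
      "M \<subseteq> {m. odd m \<and> m \<le> 2 * length E}" and sum: "sum_list E + \<Sum>M = n"
      using that by (auto simp: admissible_pairs_def)
    have "little_gollnitz (rebuild E M)" using little_gollnitz_rebuild E .
    moreover have "even_core (rebuild E M) = E" "odd_marks (rebuild E M) = M"
      using core_rebuild marks_rebuild E by auto
    ultimately show ?thesis using sum_core_marks sum by metis
  qed
  then show "(\<lambda>(E, M). rebuild E M) ` admissible_pairs n \<subseteq> {xs. little_gollnitz xs \<and> sum_list xs = n}"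
    by auto
qed

section \<open>Overpartitions flagged by parity\<close>

definition parity_flagged :: "nat \<Rightarrow> (nat \<times> bool) list set" where
  "parity_flagged n = {ps \<in> overpartitions n.
     (\<forall>x\<in>set (non_overlined ps). even x) \<and> distinct (non_overlined ps) \<and>
     (\<forall>x\<in>set (overlined ps). odd x \<and> x \<le> 2 * length (non_overlined ps))}"

definition flag_odd :: "nat list \<Rightarrow> (nat \<times> bool) list" where
  "flag_odd = map (\<lambda>x. (x, odd x))"

lemma flag_odd_simps:
  "map fst (flag_odd xs) = xs"
  "non_overlined (flag_odd xs) = filter even xs"
  "overlined (flag_odd xs) = filter odd xs"
  by (induction xs) (auto simp: flag_odd_def non_overlined_def overlined_def)

lemma strictly_decreasing_unique:
  fixes xs ys :: "nat list"
  assumes "sorted_wrt (>) xs" "sorted_wrt (>) ys" "set xs = set ys"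
  shows "xs = ys"
  using assms strict_sorted_equal[of "rev xs" "rev ys"] by (simp add: sorted_wrt_rev)

lemma strictly_decreasing_iff:
  "sorted_wrt (>) xs \<longleftrightarrow> sorted_wrt (\<ge>) xs \<and> distinct xs" for xs :: "nat list"
  by (induction xs) (auto simp: order.strict_iff_order)

text \<open>
  A repeated part would be either even and repeated among the non-overlined parts, or odd with an
  overlined occurrence that is not the last one. So all parts are distinct and the flags carry no
  information beyond parity.
\<close>

lemma parity_flagged_eq:
  "parity_flagged n = flag_odd ` {xs. sorted_wrt (>) xs \<and> (\<forall>x\<in>set xs. 0 < x) \<and> sum_list xs = n \<and>
     (\<forall>x\<in>set xs. odd x \<longrightarrow> x \<le> 2 * length (filter even xs))}" (is "_ = flag_odd ` ?X")
proof
  show "flag_odd ` ?X \<subseteq> parity_flagged n"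
  proof safe
    fix xs :: "nat list"
    assume xs: "sorted_wrt (>) xs" "\<forall>x\<in>set xs. 0 < x" "n = sum_list xs"
      and odd: "\<forall>x\<in>set xs. odd x \<longrightarrow> x \<le> 2 * length (filter even xs)"
    then have "sorted_wrt (\<ge>) xs" "distinct xs" by (simp_all add: strictly_decreasing_iff)
    moreover from \<open>distinct xs\<close> have
      "i < j \<Longrightarrow> j < length (flag_odd xs) \<Longrightarrow> fst (flag_odd xs ! i) \<noteq> fst (flag_odd xs ! j)" for i j
      by (auto simp: flag_odd_def nth_eq_iff_index_eq)
    ultimately show "flag_odd xs \<in> parity_flagged (sum_list xs)"
      using xs odd unfolding parity_flagged_def overpartitions_def partitions_def
      by (simp add: flag_odd_simps del: set_map) blast
  qed
next
  show "parity_flagged n \<subseteq> flag_odd ` ?X"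
  proof
    fix ps assume ps: "ps \<in> parity_flagged n"
    have part: "sorted_wrt (\<ge>) (map fst ps)" "\<forall>x\<in>set (map fst ps). 0 < x"
        "sum_list (map fst ps) = n"
      and last: "\<And>i j. i < j \<Longrightarrow> j < length ps \<Longrightarrow> fst (ps ! i) = fst (ps ! j) \<Longrightarrow> \<not> snd (ps ! i)"
      and evens: "\<forall>x\<in>set (non_overlined ps). even x" "distinct (non_overlined ps)"
      and odds: "\<forall>x\<in>set (overlined ps). odd x \<and> x \<le> 2 * length (non_overlined ps)"
      using ps unfolding parity_flagged_def overpartitions_def partitions_def
      by (simp_all del: set_map) blast
    have flag: "snd p \<longleftrightarrow> odd (fst p)" if "p \<in> set ps" for p
    proof (cases "snd p")
      case True
      then have "fst p \<in> set (overlined ps)" using that by (simp add: overlined_def)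
      then show ?thesis using odds True by blast
    next
      case False
      then have "fst p \<in> set (non_overlined ps)" using that by (simp add: non_overlined_def)
      then show ?thesis using evens(1) False by blast
    qed
    have ps_eq: "ps = flag_odd (map fst ps)"
      unfolding flag_odd_def map_map by (rule sym, rule map_idI) (simp add: flag prod_eq_iff)
    define xs where "xs = map fst ps"
    have split: "non_overlined ps = filter even xs" "overlined ps = filter odd xs"
      using arg_cong[OF ps_eq, of non_overlined] arg_cong[OF ps_eq, of overlined]
      unfolding flag_odd_simps xs_def by blast+
    have "distinct xs"
    proof -
      have "xs ! i \<noteq> xs ! j" if ij: "i < j" "j < length xs" for i j
      proof
        assume eq: "xs ! i = xs ! j"
        show False
        proof (cases "odd (xs ! i)")
          case True
          then have "snd (ps ! i)" using flag ij unfolding xs_def by simp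
          then show False using last[of i j] ij eq unfolding xs_def by simp
        next
          case False
          define v where "v = xs ! i"
          \<comment> \<open>An even number at positions \<open>i\<close> and \<open>j\<close> would occur twice among the non-overlined parts.\<close>
          have "xs = take j xs @ v # drop (Suc j) xs"
            using id_take_nth_drop ij(2) eq v_def by metis
          then have "filter even xs = filter even (take j xs) @ v # filter even (drop (Suc j) xs)"
            using False v_def by (metis filter.simps(2) filter_append)
          moreover have "v \<in> set (filter even (take j xs))"
            using ij False v_def by (auto simp: in_set_conv_nth intro!: exI[of _ i])
          ultimately show False using evens(2) unfolding split by auto
        qed
      qed
      then show ?thesis by (metis distinct_conv_nth nat_neq_iff)
    qed
    then have "sorted_wrt (>) xs" using part(1) by (simp add: strictly_decreasing_iff xs_def)
    moreover have "\<forall>x\<in>set xs. odd x \<longrightarrow> x \<le> 2 * length (filter even xs)"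
      using odds split by simp
    ultimately have "xs \<in> ?X" using part by (simp add: xs_def)
    then show "ps \<in> flag_odd ` ?X" using ps_eq unfolding xs_def by blast
  qed
qed

text \<open>
  Strictly decreasing lists are determined by their sets of entries, so splitting one into its even
  and odd entries is reversed by sorting the union.
\<close>

lemma bij_betw_overpartitions_pairs:
  "bij_betw (\<lambda>ps. (non_overlined ps, set (overlined ps))) (parity_flagged n) (admissible_pairs n)"
proof (rule bij_betw_imageI)
  let ?X = "{xs. sorted_wrt (>) xs \<and> (\<forall>x\<in>set xs. 0 < x) \<and> sum_list xs = n \<and>
     (\<forall>x\<in>set xs. odd x \<longrightarrow> x \<le> 2 * length (filter even xs))}"
  show "inj_on (\<lambda>ps. (non_overlined ps, set (overlined ps))) (parity_flagged n)"
  proof (rule inj_onI)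
    fix ps qs assume "ps \<in> parity_flagged n" "qs \<in> parity_flagged n"
      and eq: "(non_overlined ps, set (overlined ps)) = (non_overlined qs, set (overlined qs))"
    then obtain xs ys where xs: "ps = flag_odd xs" "sorted_wrt (>) xs"
      and ys: "qs = flag_odd ys" "sorted_wrt (>) ys"
      unfolding parity_flagged_eq by blast
    have "filter even xs = filter even ys" "set (filter odd xs) = set (filter odd ys)"
      using eq unfolding xs(1) ys(1) flag_odd_simps by simp_all
    moreover have "set zs = set (filter even zs) \<union> set (filter odd zs)" for zs :: "nat list"
      by auto
    ultimately have "set xs = set ys" by metis
    then show "ps = qs" using strictly_decreasing_unique xs ys by metis
  qed
  have sum: "sum_list xs = sum_list (filter even xs) + \<Sum>(set (filter odd xs))"
    if "sorted_wrt (>) xs" for xs :: "nat list"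
    using that by (induction xs) auto
  show "(\<lambda>ps. (non_overlined ps, set (overlined ps))) ` parity_flagged n = admissible_pairs n"
  proof
    show "(\<lambda>ps. (non_overlined ps, set (overlined ps))) ` parity_flagged n \<subseteq> admissible_pairs n"
      using sum unfolding parity_flagged_eq admissible_pairs_def
      by (auto simp only: image_iff flag_odd_simps sorted_wrt_filter mem_Collect_eq case_prod_conv
        set_filter)
    show "admissible_pairs n \<subseteq> (\<lambda>ps. (non_overlined ps, set (overlined ps))) ` parity_flagged n"
    proof clarify
      fix E M assume "(E, M) \<in> admissible_pairs n"
      then have E: "sorted_wrt (>) E" "\<forall>e\<in>set E. even e \<and> 0 < e"
        and M: "M \<subseteq> {m. odd m \<and> m \<le> 2 * length E}" and n: "sum_list E + \<Sum>M = n"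
        by (auto simp: admissible_pairs_def)
      have "finite M" using M by (rule finite_subset) simp
      define xs where "xs = rev (sorted_list_of_set (set E \<union> M))"
      have sorted: "sorted_wrt (>) xs" unfolding xs_def by (simp add: sorted_wrt_rev)
      have set: "set xs = set E \<union> M" unfolding xs_def using \<open>finite M\<close> by simp
      have "set (filter even xs) = set E" using set E M by auto
      then have even: "filter even xs = E"
        using strictly_decreasing_unique sorted_wrt_filter sorted E(1) by blast
      have odd: "set (filter odd xs) = M" using set E M by auto
      have "0 < x" if "x \<in> set xs" for x
        using that E(2) M unfolding set by (cases "x = 0") auto
      moreover have "sum_list xs = n" using sum[OF sorted] n unfolding even odd by simp
      moreover have "x \<le> 2 * length (filter even xs)" if "x \<in> set xs" "odd x" for x
        using that E(2) M unfolding set even by auto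
      ultimately have "xs \<in> ?X" using sorted by blast
      then have "flag_odd xs \<in> parity_flagged n" unfolding parity_flagged_eq by blast
      moreover have "(E, M) = (non_overlined (flag_odd xs), set (overlined (flag_odd xs)))"
        by (simp only: flag_odd_simps even odd)
      ultimately show "(E, M) \<in> (\<lambda>ps. (non_overlined ps, set (overlined ps))) ` parity_flagged n"
        by blast
    qed
  qed
qed

theorem theorem5p2:
  fixes n :: nat
  shows "LG2 n = LG2_bar n"
proof -
  have "{xs \<in> partitions n. sorted_wrt (\<lambda>x y. x \<ge> y + 2) xs \<and> 1 \<notin> set xs \<and>
      \<not> (\<exists>s::int. 2 * s + 1 \<in> int ` set xs \<and> 2 * s - 1 \<in> int ` set xs)} =
    {xs. little_gollnitz xs \<and> sum_list xs = n}" (is "?L = ?G")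
  proof (intro set_eqI iffI)
    fix xs assume "xs \<in> ?L"
    then show "xs \<in> ?G" using little_gollnitz_iff[of xs] by (simp add: partitions_def)
  next
    fix xs assume xs: "xs \<in> ?G"
    then have pos: "\<forall>x\<in>set xs. 0 < x" by (auto simp: little_gollnitz_def)
    have "sorted_wrt (\<lambda>x y. x \<ge> y + 2) xs" using xs little_gollnitz_iff[OF pos] by blast
    \<comment> \<open>\<^const>\<open>partitions\<close> asks for weak decrease, which the gap condition implies.\<close>
    then have "sorted_wrt (\<ge>) xs" by (rule sorted_wrt_mono_rel[rotated]) simp
    then show "xs \<in> ?L" using xs little_gollnitz_iff[OF pos] pos by (simp add: partitions_def)
  qed
  then have "LG2 n = card (admissible_pairs n)"
    unfolding LG2_def using bij_betw_same_card[OF bij_betw_gollnitz_pairs] by simp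
  also have "\<dots> = LG2_bar n"
    using bij_betw_same_card[OF bij_betw_overpartitions_pairs, of n]
    unfolding LG2_bar_def parity_flagged_def by simp
  finally show ?thesis .
qed

end
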